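(* For every $t\in\{2,\dots,T\}$ fix a probability measure $\nu_t\in\mathcal W_t$ (the true distribution), and let $\hat\nu_t$ be the empirical measure of $n_t$ i.i.d. samples $\hat\xi_{t,1},\dots,\hat\xi_{t,n_t}$ of $\nu_t$, samples of different stages being independent. Assume that $\langle g_{t,j},\nu_t\rangle\le\rho_{t,j}$ for all $j=1,\dots,m_t$ and all $t$. Let $v^{\mathrm{Eval}}$ be the out-of-sample evaluation mean cost of an optimal policy of the DR-MCO built from these samples, and let $Q_1(x_0;\xi_1)$ be the optimal value of that DR-MCO. Then for any $\alpha\in(0,1)$, we have $v^{\mathrm{Eval}}\le Q_1(x_0;\xi_1)$ with probability at least $\alpha$ (over the samples), if for each $t\in\{2,\dots,T\}$ at least one of the following two conditions holds: 1. $\nu_t$ is sub-Gaussian, $\delta_t\ge3$, and $$n_t\cdot\min\{\rho_{t,0}^{\delta_t},\rho_{t,0}^2\}\ \ge\ \frac1{C'_t}\Bigl[\ln C_t-\ln\bigl(1-\alpha^{1/(T-1)}\bigr)\Bigr];$$ 2. $\nu_t$ has finite third moments, $\delta_t\ge2$, and $$n_t\cdot\min\{\rho_{t,0}^{\delta_t},\rho_{t,0}^2\}\ \ge\ \max\left\{\frac1{C'_t}\Bigl[\ln (2C_t)-\ln\bigl(1-\alpha^{1/(T-1)}\bigr)\Bigr],\ \frac{2C''_t}{1-\alpha^{1/(T-1)}}\right\}.$$ Here $C_t,C'_t,C''_t>0$ are the constants, depending only on $\nu_t$, of the measure concentration bound recalled in the context. Moreover, for fixed $\alpha$ (and fixed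 constants $C_t,C_t',C_t''$), the right-hand sides of conditions 1 and 2 are $\mathcal O(\ln T)$ and $\mathcal O(T)$, respectively, as $T\to\infty$.
   Context: **DR-MCO setting.** Let $T\ge2$ and $\mathcal T=\{1,\dots,T\}$. For each $t\in\mathcal T$, the state space $\mathcal X_t$ is a convex subset of a finite-dimensional Euclidean space and $\Xi_t\subseteq\mathbb R^{\delta_t}$ is the uncertainty set; $\mathcal X_0=\{x_0\}$ and $\Xi_1=\{\xi_1\}$ are given singletons. The local cost $f_t(x_{t-1},x_t;\xi_t)\in[0,+\infty]$ is lower semicontinuous, and convex in $(x_{t-1},x_t)$ for each $\xi_t\in\Xi_t$. For $t\ge2$ let $\hat\xi_{t,1},\dots,\hat\xi_{t,n_t}\in\Xi_t$ be samples and $\hat\nu_t=\frac1{n_t}\sum_{k=1}^{n_t}\Delta_{\hat\xi_{t,k}}$ the empirical measure ($\Delta_\xi$ is the Dirac measure at $\xi$). Let $d_t(\cdot,\cdot)$ be a distance on $\Xi_t$, and let $W_t(\mu,\nu)=\inf_\pi\int d_t\,d\pi$ (infimum over couplings $\pi$ of $\mu,\nu$) be the Wasserstein distance of order 1 on probability measures on $\Xi_t$. Let $\mathcal W_t$ be the set of probability measures $\mu$ on $\Xi_t$ with $\int d_t(\bar\xi,\xi)\,d\mu(\xi)<\infty$ for some $\bar\xi\in\Xi_t$. Let $g_{t,1},\dots,g_{t,m_t}$ be continuous real functions on $\Xi_t$ with $|g_{t,j}(\xi)|\le C(1+d_t(\bar\xi,\xi))$ for some $C>0$, $\bar\xi\in\Xi_t$,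 and write $\langle g,p\rangle=\int g\,dp$. With $\rho_t=(\rho_{t,0},\dots,\rho_{t,m_t})\in\mathbb R^{m_t+1}$, $\rho_{t,0}>0$, the ambiguity set is $$\mathcal P_t=\{p\in\mathcal W_t:\ W_t(p,\hat\nu_t)\le\rho_{t,0},\ \langle g_{t,j},p\rangle\le\rho_{t,j},\ j=1,\dots,m_t\}.$$ Cost-to-go and value functions are defined recursively by $\mathcal Q_T\equiv0$, $$Q_t(x_{t-1};\xi_t)=\inf_{x_t\in\mathcal X_t}f_t(x_{t-1},x_t;\xi_t)+\mathcal Q_t(x_t),\qquad \mathcal Q_{t-1}(x_{t-1})=\sup_{p_t\in\mathcal P_t}\int_{\Xi_t}Q_t(x_{t-1};\xi_t)\,dp_t(\xi_t).$$ The optimal value of the DR-MCO is $Q_1(x_0;\xi_1)$. **Out-of-sample evaluation.** Fix an optimal policy: $x_1^*\in\arg\min_{x_1\in\mathcal X_1}\{f_1(x_0,x_1;\xi_1)+\mathcal Q_1(x_1)\}$ and maps $x_t^*:\mathcal X_{t-1}\times\Xi_t\to\mathcal X_t$, $t=2,\dots,T$, with $x_t^*(x_{t-1},\cdot)$ Borel measurable and $x_t^*(x_{t-1},\xi_t)\in\arg\min_{x_t\in\mathcal X_t}\{f_t(x_{t-1},x_t;\xi_t)+\mathcal Q_t(x_t)\}$ for all $x_{t-1},\xi_t$. Define $\mathcal Q_T^{\mathrm{Eval}}\equiv0$, $$\mathcal Q_{t-1}^{\mathrm{Eval}}(x_{t-1})=\int_{\Xi_t}\bigl[f_t(x_{t-1},x_t^*(x_{t-1},\xi_t);\xi_t)+\mathcal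 Q_t^{\mathrm{Eval}}(x_t^*(x_{t-1},\xi_t))\bigr]d\nu_t(\xi_t),$$ and $v^{\mathrm{Eval}}=f_1(x_0,x_1^*;\xi_1)+\mathcal Q_1^{\mathrm{Eval}}(x_1^* )$. **Tail conditions.** $\mu\in\mathcal W_t$ is sub-Gaussian if $\sup_{\|u\|=1}\int\exp(C(u^{\mathsf T}\xi)^2)\,d\mu(\xi)<\infty$ for some $C>0$; it has finite third moments if $\int\|\xi\|^3d\mu(\xi)<\infty$. **Constants (known concentration bound of Fournier–Guillin, taken as given).** $C_t,C'_t,C''_t>0$ depend only on $\nu_t$ and are such that for all $n_t$ and $\rho_{t,0}>0$, $\mathbb P(W_t(\nu_t,\hat\nu_t)>\rho_{t,0})$ is at most $C_t\exp(-C'_tn_t\rho_{t,0}^{\delta_t})\mathbf 1_{\{\rho_{t,0}\le1\}}+C_t\exp(-C'_tn_t\rho_{t,0}^2)\mathbf 1_{\{\rho_{t,0}>1\}}$ if $\nu_t$ is sub-Gaussian and $\delta_t\ge3$, and at most $C_t\exp(-C'_tn_t\rho_{t,0}^{\delta_t})\mathbf 1_{\{\rho_{t,0}\le1\}}+C''_t(n_t\rho_{t,0}^2)^{-1}$ if $\nu_t$ has finite third moments. *)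

theory Defs
  imports "HOL-Probability.Probability" "HOL-Library.Landau_Symbols"
begin

section \<open>Events of possibly non-measurable sets\<close>

text \<open>
  The out-of-sample cost depends on the samples through an arbitrary choice of an optimal policy,
  so the event that it is bounded by the optimal value need not be measurable. ``Probability at
  least \<open>a\<close>'' therefore means that a measurable subset has probability at least \<open>a\<close>, and ``probability at
  most \<open>b\<close>'' is expressed by \<^const>\<open>outer_measure_of\<close>. For measurable sets both agree with the usual
  meaning.
\<close>

definition prob_at_least :: "'s measure \<Rightarrow> 's set \<Rightarrow> real \<Rightarrow> bool" where
  "prob_at_least M A a \<longleftrightarrow> (\<exists>B\<in>sets M. B \<subseteq> A \<and> a \<le> measure M B)"

lemma prob_at_least_iff:
  assumes "prob_space M" "A \<in> sets M"
  shows "prob_at_least M A a \<longleftrightarrow> a \<le> measure M A"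
proof -
  interpret prob_space M by fact
  show ?thesis
    unfolding prob_at_least_def using assms(2) by (meson finite_measure_mono order_refl order_trans)
qed

section \<open>Convexity and lower semicontinuity of extended-valued functions\<close>

text \<open>At the endpoints of the segment the convention is \<open>0 * \<infinity> = 0\<close>, where the inequality is trivial.\<close>

definition ennreal_convex_on :: "'v::real_vector set \<Rightarrow> ('v \<Rightarrow> ennreal) \<Rightarrow> bool" where
  "ennreal_convex_on S h \<longleftrightarrow>
     (\<forall>a\<in>S. \<forall>b\<in>S. \<forall>u\<in>{0..1}.
        h ((1 - u) *\<^sub>R a + u *\<^sub>R b) \<le> ennreal (1 - u) * h a + ennreal u * h b)"

definition lsc_on :: "'v::topological_space set \<Rightarrow> ('v \<Rightarrow> ennreal) \<Rightarrow> bool" where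
  "lsc_on S h \<longleftrightarrow> (\<forall>z\<in>S. h z \<le> Liminf (at z within S) h)"

section \<open>Probability measures on an uncertainty set\<close>

text \<open>
  The uncertainty set \<open>S\<close> carries the trace of the Borel sigma-algebra. Integrals of
  \<open>[0,\<infinity>]\<close>-valued functions are \<^const>\<open>nn_integral\<close>. For value functions that are not Borel
  measurable this is the lower integral, which for universally measurable functions equals the
  integral with respect to the completed measure.
\<close>

abbreviation borel_on :: "'e::topological_space set \<Rightarrow> 'e measure" where
  "borel_on S \<equiv> restrict_space borel S"

definition wasserstein_space :: "'e::topological_space set \<Rightarrow> ('e \<Rightarrow> 'e \<Rightarrow> real) \<Rightarrow> 'e measure set" where
  "wasserstein_space S d =
     {\<mu>. prob_space \<mu> \<and> sets \<mu> = sets (borel_on S) \<and>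
          (\<exists>z\<in>S. (\<integral>\<^sup>+ \<xi>. ennreal (d z \<xi>) \<partial>\<mu>) < \<infinity>)}"

definition couplings ::
    "'e::topological_space set \<Rightarrow> 'e measure \<Rightarrow> 'e measure \<Rightarrow> ('e \<times> 'e) measure set" where
  "couplings S \<mu> \<nu> =
     {\<pi>. sets \<pi> = sets (borel_on S \<Otimes>\<^sub>M borel_on S) \<and>
         distr \<pi> (borel_on S) fst = \<mu> \<and> distr \<pi> (borel_on S) snd = \<nu>}"

definition wasserstein ::
    "'e::topological_space set \<Rightarrow> ('e \<Rightarrow> 'e \<Rightarrow> real) \<Rightarrow> 'e measure \<Rightarrow> 'e measure \<Rightarrow> ennreal" where
  "wasserstein S d \<mu> \<nu> = (INF \<pi>\<in>couplings S \<mu> \<nu>. \<integral>\<^sup>+ z. ennreal (d (fst z) (snd z)) \<partial>\<pi>)"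

definition empirical_measure ::
    "'e::topological_space set \<Rightarrow> nat \<Rightarrow> (nat \<Rightarrow> 'e) \<Rightarrow> 'e measure" where
  "empirical_measure S n s =
     measure_of S (sets (borel_on S))
       (\<lambda>A. (\<Sum>k=1..n. emeasure (return (borel_on S) (s k)) A) / of_nat n)"

lemma emeasure_empirical_measure:
  assumes "A \<in> sets (borel_on S)"
  shows "emeasure (empirical_measure S n s) A = (\<Sum>k=1..n. indicator A (s k)) / of_nat n"
proof -
  let ?\<mu> = "\<lambda>A. (\<Sum>k=1..n. emeasure (return (borel_on S) (s k)) A) / of_nat n"
  have sp: "space (borel_on S) = S"
    by (simp add: space_restrict_space)
  have ca: "countably_additive (sets (borel_on S)) ?\<mu>"
  proof (rule countably_additiveI)
    fix F :: "nat \<Rightarrow> _"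
    assume F: "range F \<subseteq> sets (borel_on S)" "disjoint_family F"
    have "(\<Sum>i. ?\<mu> (F i)) = (\<Sum>i. \<Sum>k=1..n. emeasure (return (borel_on S) (s k)) (F i)) / of_nat n"
      by (simp add: divide_ennreal_def)
    also have "(\<Sum>i. \<Sum>k=1..n. emeasure (return (borel_on S) (s k)) (F i)) =
        (\<Sum>k=1..n. \<Sum>i. emeasure (return (borel_on S) (s k)) (F i))"
      by (intro suminf_sum) auto
    also have "\<dots> = (\<Sum>k=1..n. emeasure (return (borel_on S) (s k)) (\<Union>i. F i))"
      using F by (intro sum.cong refl suminf_emeasure) auto
    finally show "(\<Sum>i. ?\<mu> (F i)) = ?\<mu> (\<Union>i. F i)" .
  qed
  have "emeasure (empirical_measure S n s) A = ?\<mu> A"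
    unfolding empirical_measure_def
  proof (rule emeasure_measure_of_sigma)
    show "sigma_algebra S (sets (borel_on S))"
      using sets.sigma_algebra_axioms[of "borel_on S"] sp by simp
    show "positive (sets (borel_on S)) ?\<mu>"
      by (simp add: positive_def)
  qed (use ca assms in auto)
  then show ?thesis
    using assms by (simp add: emeasure_return)
qed

text \<open>
  The Euclidean space \<open>\<real>\<^sup>\<delta>\<close> containing the uncertainty set is a \<open>\<delta>\<close>-dimensional linear subspace \<open>E\<close>
  of an ambient Euclidean space, so that the dimension may vary from stage to stage.
\<close>

definition sub_gaussian :: "'e::euclidean_space set \<Rightarrow> 'e measure \<Rightarrow> bool" where
  "sub_gaussian E \<mu> \<longleftrightarrow>
     (\<exists>c>0. (SUP u\<in>{u\<in>E. norm u = 1}. \<integral>\<^sup>+ \<xi>. ennreal (exp (c * (u \<bullet> \<xi>)\<^sup>2)) \<partial>\<mu>) < \<infinity>)"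

definition finite_third_moments :: "'e::euclidean_space measure \<Rightarrow> bool" where
  "finite_third_moments \<mu> \<longleftrightarrow> (\<integral>\<^sup>+ \<xi>. ennreal (norm \<xi> ^ 3) \<partial>\<mu>) < \<infinity>"

definition ambiguity_set ::
    "'e::topological_space set \<Rightarrow> ('e \<Rightarrow> 'e \<Rightarrow> real) \<Rightarrow> 'e measure \<Rightarrow> nat \<Rightarrow> (nat \<Rightarrow> 'e \<Rightarrow> real)
      \<Rightarrow> (nat \<Rightarrow> real) \<Rightarrow> 'e measure set" where
  "ambiguity_set S d \<mu> m g \<rho> =
     {p \<in> wasserstein_space S d.
        wasserstein S d p \<mu> \<le> ennreal (\<rho> 0) \<and> (\<forall>j\<in>{1..m}. (\<integral>\<xi>. g j \<xi> \<partial>p) \<le> \<rho> j)}"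

text \<open>
  The Fournier--Guillin bound for the distribution \<open>\<nu>\<close> with constants \<open>c\<close>, \<open>c'\<close>, \<open>c''\<close>; the samples
  \<open>s 1, \<dots>, s n\<close> are the coordinates of the product space.
\<close>

definition concentration_bound ::
    "'e::euclidean_space set \<Rightarrow> 'e set \<Rightarrow> ('e \<Rightarrow> 'e \<Rightarrow> real) \<Rightarrow> 'e measure
      \<Rightarrow> real \<Rightarrow> real \<Rightarrow> real \<Rightarrow> bool" where
  "concentration_bound E S d \<nu> c c' c'' \<longleftrightarrow>
     (\<forall>n\<ge>1. \<forall>r>0.
        let M = PiM {1..n} (\<lambda>_. \<nu>);
            p = outer_measure_of M
                  {s \<in> space M. wasserstein S d \<nu> (empirical_measure S n s) > ennreal r}
        in (sub_gaussian E \<nu> \<and> dim E \<ge> 3 \<longrightarrow>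
              p \<le> ennreal (c * exp (- c' * real n * r ^ dim E) * of_bool (r \<le> 1)
                         + c * exp (- c' * real n * r\<^sup>2) * of_bool (r > 1))) \<and>
           (finite_third_moments \<nu> \<longrightarrow>
              p \<le> ennreal (c * exp (- c' * real n * r ^ dim E) * of_bool (r \<le> 1)
                         + c'' * inverse (real n * r\<^sup>2))))"

section \<open>The multistage problem and its out-of-sample evaluation\<close>

text \<open>
  \<open>T\<close> is the horizon, \<open>X t\<close> the state spaces, \<open>f t\<close> the local costs and \<open>P t\<close> the ambiguity sets.
  With \<open>V\<close> the cost-to-go function of stage \<open>t\<close>, \<open>stage_value X f V t\<close> is the value function of that
  stage.
\<close>

definition stage_value ::
    "(nat \<Rightarrow> 'x set) \<Rightarrow> (nat \<Rightarrow> 'x \<Rightarrow> 'x \<Rightarrow> 'e \<Rightarrow> ennreal) \<Rightarrow> ('x \<Rightarrow> ennreal)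
      \<Rightarrow> nat \<Rightarrow> 'x \<Rightarrow> 'e \<Rightarrow> ennreal" where
  "stage_value X f V t x \<xi> = (INF y\<in>X t. f t x y \<xi> + V y)"

function cost_to_go ::
    "nat \<Rightarrow> (nat \<Rightarrow> 'x set) \<Rightarrow> (nat \<Rightarrow> 'x \<Rightarrow> 'x \<Rightarrow> 'e \<Rightarrow> ennreal) \<Rightarrow> (nat \<Rightarrow> 'e measure set)
      \<Rightarrow> nat \<Rightarrow> 'x \<Rightarrow> ennreal" where
  "cost_to_go T X f P t =
     (if t < T
      then (\<lambda>x. SUP p\<in>P (Suc t).
              \<integral>\<^sup>+ \<xi>. stage_value X f (cost_to_go T X f P (Suc t)) (Suc t) x \<xi> \<partial>p)
      else (\<lambda>_. 0))"
  by pat_completeness auto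
termination by (relation "Wellfounded.measure (\<lambda>(T, X, f, P, t). T - t)") auto

declare cost_to_go.simps [simp del]

definition value_function ::
    "nat \<Rightarrow> (nat \<Rightarrow> 'x set) \<Rightarrow> (nat \<Rightarrow> 'x \<Rightarrow> 'x \<Rightarrow> 'e \<Rightarrow> ennreal) \<Rightarrow> (nat \<Rightarrow> 'e measure set)
      \<Rightarrow> nat \<Rightarrow> 'x \<Rightarrow> 'e \<Rightarrow> ennreal" where
  "value_function T X f P t = stage_value X f (cost_to_go T X f P t) t"

text \<open>
  A policy consists of the first-stage decision \<open>x1\<close> and of the maps \<open>pol t\<close> for the later stages.
\<close>

definition optimal_policy ::
    "nat \<Rightarrow> (nat \<Rightarrow> 'x::topological_space set) \<Rightarrow> (nat \<Rightarrow> 'e::topological_space set)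
      \<Rightarrow> (nat \<Rightarrow> 'x \<Rightarrow> 'x \<Rightarrow> 'e \<Rightarrow> ennreal) \<Rightarrow> (nat \<Rightarrow> 'e measure set) \<Rightarrow> 'x \<Rightarrow> 'e
      \<Rightarrow> 'x \<Rightarrow> (nat \<Rightarrow> 'x \<Rightarrow> 'e \<Rightarrow> 'x) \<Rightarrow> bool" where
  "optimal_policy T X \<Xi> f P x0 \<xi>1 x1 pol \<longleftrightarrow>
     is_arg_min (\<lambda>y. f 1 x0 y \<xi>1 + cost_to_go T X f P 1 y) (\<lambda>y. y \<in> X 1) x1 \<and>
     (\<forall>t\<in>{2..T}. \<forall>x\<in>X (t - 1).
        pol t x \<in> measurable (borel_on (\<Xi> t)) borel \<and>
        (\<forall>\<xi>\<in>\<Xi> t. is_arg_min (\<lambda>y. f t x y \<xi> + cost_to_go T X f P t y) (\<lambda>y. y \<in> X t) (pol t x \<xi>)))"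

function eval_cost_to_go ::
    "nat \<Rightarrow> (nat \<Rightarrow> 'x \<Rightarrow> 'x \<Rightarrow> 'e \<Rightarrow> ennreal) \<Rightarrow> (nat \<Rightarrow> 'e measure)
      \<Rightarrow> (nat \<Rightarrow> 'x \<Rightarrow> 'e \<Rightarrow> 'x) \<Rightarrow> nat \<Rightarrow> 'x \<Rightarrow> ennreal" where
  "eval_cost_to_go T f \<nu> pol t =
     (if t < T
      then (\<lambda>x. \<integral>\<^sup>+ \<xi>. f (Suc t) x (pol (Suc t) x \<xi>) \<xi>
                     + eval_cost_to_go T f \<nu> pol (Suc t) (pol (Suc t) x \<xi>) \<partial>\<nu> (Suc t))
      else (\<lambda>_. 0))"
  by pat_completeness auto
termination by (relation "Wellfounded.measure (\<lambda>(T, f, \<nu>, pol, t). T - t)") auto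

declare eval_cost_to_go.simps [simp del]

definition eval_cost ::
    "nat \<Rightarrow> (nat \<Rightarrow> 'x \<Rightarrow> 'x \<Rightarrow> 'e \<Rightarrow> ennreal) \<Rightarrow> (nat \<Rightarrow> 'e measure) \<Rightarrow> 'x \<Rightarrow> 'e
      \<Rightarrow> 'x \<Rightarrow> (nat \<Rightarrow> 'x \<Rightarrow> 'e \<Rightarrow> 'x) \<Rightarrow> ennreal" where
  "eval_cost T f \<nu> x0 \<xi>1 x1 pol = f 1 x0 x1 \<xi>1 + eval_cost_to_go T f \<nu> pol 1 x1"

section \<open>Sample size thresholds\<close>

definition threshold_sub_gaussian :: "real \<Rightarrow> nat \<Rightarrow> real \<Rightarrow> real \<Rightarrow> real" where
  "threshold_sub_gaussian \<alpha> T c c' = 1 / c' * (ln c - ln (1 - \<alpha> powr (1 / (real T - 1))))"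

definition threshold_third_moments :: "real \<Rightarrow> nat \<Rightarrow> real \<Rightarrow> real \<Rightarrow> real \<Rightarrow> real" where
  "threshold_third_moments \<alpha> T c c' c'' =
     max (1 / c' * (ln (2 * c) - ln (1 - \<alpha> powr (1 / (real T - 1)))))
         (2 * c'' / (1 - \<alpha> powr (1 / (real T - 1))))"

end

theory Submission
  imports Defs "HOL-Real_Asymp.Real_Asymp"
begin

text \<open>
  The guarantee has a deterministic and a probabilistic half. Deterministically, if the true
  distribution of every stage lies in that stage's ambiguity set, then the out-of-sample cost is at
  most the optimal value: stage by stage, backwards in time, the optimal policy attains the infimum
  in the value function, and the worst-case expectation over the ambiguity set dominates the
  expectation under the true distribution (\<open>eval_cost_le_value_function\<close>). The true distribution
  satisfies the moment constraints by assumption, so stage \<open>t\<close> can only fail because the empirical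
  measure is at Wasserstein distance more than \<open>\<rho> t 0\<close> from it.

  Probabilistically, put \<open>\<beta> = \<alpha> powr (1 / (T - 1))\<close>. The sample sizes are such that the concentration
  bound makes a single stage fail with probability at most \<open>1 - \<beta>\<close> (\<open>wasserstein_tail_le\<close>). The
  stages are independent and there are \<open>T - 1\<close> of them, so all succeed together with probability at
  least \<open>\<beta> ^ (T - 1) = \<alpha>\<close> (\<open>indep_vars_prob_avoid\<close>). The failure events need not be measurable. Each
  is therefore first enlarged, within the space of samples of its own stage, to a measurable set of
  the same outer measure; since the enlargement involves one stage only, independence survives.

  The growth of the thresholds in \<open>T\<close> comes from
  \<open>1 - \<alpha> powr (1 / (T - 1)) = 1 - exp (ln \<alpha> / (T - 1))\<close>, which is asymptotically
  \<open>- ln \<alpha> / T\<close>: its logarithm is of order \<open>ln T\<close> and its reciprocal of order \<open>T\<close>.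
\<close>

section \<open>Evaluating an optimal policy under a distribution in the ambiguity set\<close>

text \<open>
  Backward induction. An optimal decision turns local cost plus cost-to-go into the value function of
  its stage, and the supremum over the ambiguity set dominates the integral under the true
  distribution. The value functions may be non-measurable; \<^const>\<open>nn_integral\<close>, being a lower
  integral, is monotone on all functions.
\<close>

lemma eval_cost_to_go_le_cost_to_go:
  assumes pol: "\<And>s x \<xi>. s \<in> {2..T} \<Longrightarrow> x \<in> X (s - 1) \<Longrightarrow> \<xi> \<in> space (\<nu> s) \<Longrightarrow>
      is_arg_min (\<lambda>y. f s x y \<xi> + cost_to_go T X f P s y) (\<lambda>y. y \<in> X s) (pol s x \<xi>)"
    and mem: "\<And>s. s \<in> {2..T} \<Longrightarrow> \<nu> s \<in> P s"
    and "1 \<le> t" "x \<in> X t"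
  shows "eval_cost_to_go T f \<nu> pol t x \<le> cost_to_go T X f P t x"
  using assms(3,4)
proof (induction "T - t" arbitrary: t x rule: less_induct)
  case less
  show ?case
  proof (cases "t < T")
    case False
    then show ?thesis
      by (simp add: eval_cost_to_go.simps)
  next
    case True
    let ?s = "Suc t" and ?V = "cost_to_go T X f P (Suc t)"
    have s: "?s \<in> {2..T}" "x \<in> X (?s - 1)"
      using True less.prems by auto
    have "eval_cost_to_go T f \<nu> pol t x =
        (\<integral>\<^sup>+ \<xi>. f ?s x (pol ?s x \<xi>) \<xi> + eval_cost_to_go T f \<nu> pol ?s (pol ?s x \<xi>) \<partial>\<nu> ?s)"
      using True by (subst eval_cost_to_go.simps) simp
    also have "\<dots> \<le> (\<integral>\<^sup>+ \<xi>. stage_value X f ?V ?s x \<xi> \<partial>\<nu> ?s)"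
    proof (rule nn_integral_mono)
      fix \<xi> assume "\<xi> \<in> space (\<nu> ?s)"
      then have min: "pol ?s x \<xi> \<in> X ?s"
        "\<And>y. y \<in> X ?s \<Longrightarrow> f ?s x (pol ?s x \<xi>) \<xi> + ?V (pol ?s x \<xi>) \<le> f ?s x y \<xi> + ?V y"
        using pol[OF s] by (auto simp: is_arg_min_linorder)
      have "eval_cost_to_go T f \<nu> pol ?s (pol ?s x \<xi>) \<le> ?V (pol ?s x \<xi>)"
        using less.hyps[of ?s "pol ?s x \<xi>"] True min(1) by auto
      then have "f ?s x (pol ?s x \<xi>) \<xi> + eval_cost_to_go T f \<nu> pol ?s (pol ?s x \<xi>)
          \<le> f ?s x (pol ?s x \<xi>) \<xi> + ?V (pol ?s x \<xi>)"
        by (rule add_left_mono)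
      also have "\<dots> \<le> stage_value X f ?V ?s x \<xi>"
        unfolding stage_value_def using min(2) by (intro INF_greatest)
      finally show "f ?s x (pol ?s x \<xi>) \<xi> + eval_cost_to_go T f \<nu> pol ?s (pol ?s x \<xi>)
          \<le> stage_value X f ?V ?s x \<xi>" .
    qed
    also have "\<dots> \<le> cost_to_go T X f P t x"
      using True by (subst (2) cost_to_go.simps) (auto intro!: SUP_upper mem s)
    finally show ?thesis .
  qed
qed

lemma eval_cost_le_value_function:
  assumes policy: "optimal_policy T X \<Xi> f P x0 \<xi>1 x1 pol"
    and space: "\<And>s. s \<in> {2..T} \<Longrightarrow> space (\<nu> s) = \<Xi> s"
    and mem: "\<And>s. s \<in> {2..T} \<Longrightarrow> \<nu> s \<in> P s"
  shows "eval_cost T f \<nu> x0 \<xi>1 x1 pol \<le> value_function T X f P 1 x0 \<xi>1"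
proof -
  let ?V = "cost_to_go T X f P 1"
  have min: "x1 \<in> X 1" "\<And>y. y \<in> X 1 \<Longrightarrow> f 1 x0 x1 \<xi>1 + ?V x1 \<le> f 1 x0 y \<xi>1 + ?V y"
    using policy unfolding optimal_policy_def is_arg_min_linorder by auto
  have "eval_cost T f \<nu> x0 \<xi>1 x1 pol \<le> f 1 x0 x1 \<xi>1 + ?V x1"
    unfolding eval_cost_def
  proof (intro add_left_mono eval_cost_to_go_le_cost_to_go)
    show "is_arg_min (\<lambda>y. f s x y \<xi> + cost_to_go T X f P s y) (\<lambda>y. y \<in> X s) (pol s x \<xi>)"
      if "s \<in> {2..T}" "x \<in> X (s - 1)" "\<xi> \<in> space (\<nu> s)" for s x \<xi>
      using policy that space unfolding optimal_policy_def by auto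
  qed (use mem min(1) in auto)
  also have "\<dots> \<le> value_function T X f P 1 x0 \<xi>1"
    unfolding value_function_def stage_value_def using min(2) by (intro INF_greatest)
  finally show ?thesis .
qed

section \<open>Independence of the stages\<close>

text \<open>
  Samples that are independent across all pairs of stage and index are grouped by stage. The groups
  are again independent, and each is distributed as the product of its members' laws, which is the
  sample space in which the concentration bound is stated. The maps \<open>?h t\<close> only rename the index
  \<open>(t, k)\<close> to \<open>k\<close>.
\<close>

lemma (in prob_space)
  assumes indep: "indep_vars (\<lambda>(t, k). N t) (\<lambda>(t, k). X t k) (SIGMA t:I. J t)"
  shows indep_vars_blocks:
      "indep_vars (\<lambda>t. PiM (J t) (\<lambda>_. N t)) (\<lambda>t \<omega>. \<lambda>k\<in>J t. X t k \<omega>) I"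
    and distr_block: "t \<in> I \<Longrightarrow> J t \<noteq> {} \<Longrightarrow>
      distr M (PiM (J t) (\<lambda>_. N t)) (\<lambda>\<omega>. \<lambda>k\<in>J t. X t k \<omega>) = PiM (J t) (\<lambda>k. distr M (N t) (X t k))"
proof -
  let ?K = "\<lambda>t. {t} \<times> J t" and ?N = "\<lambda>(t, k). N t" and ?X = "\<lambda>(t, k). X t k"
  let ?h = "\<lambda>t s. \<lambda>k\<in>J t. s (t, k)"
  have h: "?h t \<in> measurable (PiM (?K t) ?N) (PiM (J t) (\<lambda>_. N t))" for t
  proof (rule measurable_restrict)
    fix k assume "k \<in> J t"
    then show "(\<lambda>s. s (t, k)) \<in> measurable (PiM (?K t) ?N) (N t)"
      using measurable_component_singleton[of "(t, k)" "?K t" ?N] by simp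
  qed
  have h_restrict: "?h t (\<lambda>i\<in>?K t. ?X i \<omega>) = (\<lambda>k\<in>J t. X t k \<omega>)" for t \<omega>
    by (auto simp: restrict_def fun_eq_iff)
  have "indep_vars (\<lambda>t. PiM (?K t) ?N) (\<lambda>t \<omega>. \<lambda>i\<in>?K t. ?X i \<omega>) I"
    by (rule indep_vars_restrict[OF indep]) (auto simp: disjoint_family_on_def)
  from indep_vars_compose2[OF this h]
  show "indep_vars (\<lambda>t. PiM (J t) (\<lambda>_. N t)) (\<lambda>t \<omega>. \<lambda>k\<in>J t. X t k \<omega>) I"
    unfolding h_restrict .

  assume t: "t \<in> I" "J t \<noteq> {}"
  have sub: "indep_vars ?N ?X (?K t)"
    using t by (intro indep_vars_subset[OF indep]) auto
  have rv: "random_variable (?N i) (?X i)" if "i \<in> ?K t" for i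
    using sub that unfolding indep_vars_def by blast
  have "distr M (PiM (J t) (\<lambda>_. N t)) (\<lambda>\<omega>. \<lambda>k\<in>J t. X t k \<omega>) =
      distr (distr M (PiM (?K t) ?N) (\<lambda>\<omega>. \<lambda>i\<in>?K t. ?X i \<omega>)) (PiM (J t) (\<lambda>_. N t)) (?h t)"
    using h rv by (subst distr_distr) (auto simp: h_restrict[symmetric] comp_def intro!: measurable_restrict)
  also have "\<dots> = distr (PiM (?K t) (\<lambda>i. distr M (?N i) (?X i))) (PiM (J t) (\<lambda>_. N t)) (?h t)"
    using indep_vars_iff_distr_eq_PiM'[where I = "?K t" and M' = ?N and X = ?X] sub rv t by auto
  also have "\<dots> = distr (PiM (?K t) (\<lambda>i. distr M (?N i) (?X i)))
      (PiM (J t) (\<lambda>k. distr M (?N (t, k)) (?X (t, k)))) (?h t)"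
    by (intro distr_cong sets_PiM_cong) auto
  also have "\<dots> = PiM (J t) (\<lambda>k. distr M (?N (t, k)) (?X (t, k)))"
    using rv by (intro distr_PiM_reindex prob_space_distr) (auto simp: inj_on_def)
  finally show "distr M (PiM (J t) (\<lambda>_. N t)) (\<lambda>\<omega>. \<lambda>k\<in>J t. X t k \<omega>) =
      PiM (J t) (\<lambda>k. distr M (N t) (X t k))"
    by simp
qed

lemma (in prob_space) indep_vars_prob_avoid:
  assumes indep: "indep_vars N Y I" and I: "finite I" "I \<noteq> {}"
    and B: "\<And>t. t \<in> I \<Longrightarrow> B t \<in> sets (N t)"
    and le: "\<And>t. t \<in> I \<Longrightarrow> measure (distr M (N t) (Y t)) (B t) \<le> 1 - \<beta>"
    and "0 \<le> \<beta>"
  shows "{\<omega> \<in> space M. \<forall>t\<in>I. Y t \<omega> \<notin> B t} \<in> events"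
    and "\<beta> ^ card I \<le> prob {\<omega> \<in> space M. \<forall>t\<in>I. Y t \<omega> \<notin> B t}"
proof -
  have Y: "Y t \<in> measurable M (N t)" if "t \<in> I" for t
    using indep that unfolding indep_vars_def by blast
  let ?G = "\<lambda>t. Y t -` (space (N t) - B t) \<inter> space M"
  have G: "{\<omega> \<in> space M. \<forall>t\<in>I. Y t \<omega> \<notin> B t} = (\<Inter>t\<in>I. ?G t)"
    using I Y by (auto dest: measurable_space)
  have ev: "?G t \<in> events" if "t \<in> I" for t
    using Y[OF that] B[OF that] by (intro measurable_sets) auto
  then show "{\<omega> \<in> space M. \<forall>t\<in>I. Y t \<omega> \<notin> B t} \<in> events"
    unfolding G using I by (intro sets.finite_INT) auto
  have "\<beta> \<le> prob (?G t)" if "t \<in> I" for t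
  proof -
    have "?G t = space M - (Y t -` B t \<inter> space M)"
      using Y[OF that] by (auto dest: measurable_space)
    then have "prob (?G t) = 1 - prob (Y t -` B t \<inter> space M)"
      using Y[OF that] B[OF that] by (simp add: prob_compl measurable_sets)
    then show ?thesis
      using le[OF that] measure_distr[OF Y[OF that] B[OF that]] by simp
  qed
  then have "(\<Prod>t\<in>I. \<beta>) \<le> (\<Prod>t\<in>I. prob (?G t))"
    using \<open>0 \<le> \<beta>\<close> by (intro prod_mono) auto
  also have "\<dots> = prob (\<Inter>t\<in>I. ?G t)"
    using indep I B by (intro indep_varsD_finite[symmetric]) auto
  finally show "\<beta> ^ card I \<le> prob {\<omega> \<in> space M. \<forall>t\<in>I. Y t \<omega> \<notin> B t}"
    unfolding G by simp
qed

section \<open>Sample sizes that make the concentration bound small\<close>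

text \<open>The thresholds are the solutions of \<open>c * exp (- c' * a) = q\<close> for the exponent \<open>a\<close>.\<close>

lemma exp_tail_le:
  fixes a c c' q :: real
  assumes "0 < c" "0 < c'" "0 < q" "1 / c' * (ln c - ln q) \<le> a"
  shows "c * exp (- c' * a) \<le> q"
proof -
  have "ln c - ln q \<le> c' * a"
    using assms by (simp add: field_simps)
  then have "exp (ln c + (- c' * a)) \<le> exp (ln q)"
    by simp
  then show ?thesis
    using assms unfolding exp_add by simp
qed

text \<open>
  The single quantity \<open>min (r ^ k) (r\<^sup>2)\<close> in the sample size conditions encodes the two regimes of the
  concentration bound.
\<close>

lemma min_power_square:
  fixes r :: real
  assumes "0 < r" "2 \<le> k"
  shows "min (r ^ k) (r\<^sup>2) = (if r \<le> 1 then r ^ k else r\<^sup>2)"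
  using assms power_decreasing[of 2 k r] power_increasing[of 2 k r] by auto

text \<open>
  In the sub-Gaussian case exactly one of the two exponential terms is present, and it gets the whole
  failure level \<open>q\<close>. With third moments the exponential and the polynomial term may occur together, so
  each gets \<open>q / 2\<close>, which is the origin of the factors \<open>2\<close> in the second threshold.
\<close>

lemma wasserstein_tail_le:
  assumes bound: "concentration_bound E S d \<nu> c c' c''"
    and pos: "0 < c" "0 < c'" "0 < c''" "0 < r" "0 < q" and n: "1 \<le> n"
    and size:
      "sub_gaussian E \<nu> \<and> 3 \<le> dim E \<and>
         1 / c' * (ln c - ln q) \<le> real n * min (r ^ dim E) (r\<^sup>2) \<or>
       finite_third_moments \<nu> \<and> 2 \<le> dim E \<and>
         max (1 / c' * (ln (2 * c) - ln q)) (2 * c'' / q) \<le> real n * min (r ^ dim E) (r\<^sup>2)"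
  shows "outer_measure_of (PiM {1..n} (\<lambda>_. \<nu>))
      {s \<in> space (PiM {1..n} (\<lambda>_. \<nu>)). wasserstein S d \<nu> (empirical_measure S n s) > ennreal r}
    \<le> ennreal q" (is "?p \<le> _")
  using size
proof (elim disjE conjE)
  assume 1: "sub_gaussian E \<nu>" "3 \<le> dim E"
    "1 / c' * (ln c - ln q) \<le> real n * min (r ^ dim E) (r\<^sup>2)"
  have "?p \<le> ennreal (c * exp (- c' * real n * r ^ dim E) * of_bool (r \<le> 1)
                     + c * exp (- c' * real n * r\<^sup>2) * of_bool (r > 1))"
    using bound n \<open>0 < r\<close> 1 unfolding concentration_bound_def Let_def by blast
  also have "\<dots> = ennreal (c * exp (- c' * (real n * min (r ^ dim E) (r\<^sup>2))))"
    using min_power_square[of r "dim E"] 1 \<open>0 < r\<close> by (simp add: mult.assoc)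
  also have "\<dots> \<le> ennreal q"
    using pos 1 by (intro ennreal_leI exp_tail_le)
  finally show ?thesis .
next
  assume 2: "finite_third_moments \<nu>" "2 \<le> dim E"
    "max (1 / c' * (ln (2 * c) - ln q)) (2 * c'' / q) \<le> real n * min (r ^ dim E) (r\<^sup>2)"
  have "c * exp (- c' * real n * r ^ dim E) * of_bool (r \<le> 1) \<le> q / 2"
  proof (cases "r \<le> 1")
    case True
    then have "2 * c * exp (- c' * (real n * r ^ dim E)) \<le> q"
      using pos 2 min_power_square[of r "dim E"] by (intro exp_tail_le) auto
    then show ?thesis
      using True by (simp add: mult.assoc)
  qed (use pos in auto)
  moreover have "c'' * inverse (real n * r\<^sup>2) \<le> q / 2"
  proof -
    have "2 * c'' / q \<le> real n * r\<^sup>2"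
      using 2(3) mult_left_mono[of "min (r ^ dim E) (r\<^sup>2)" "r\<^sup>2" "real n"] by simp
    then show ?thesis
      using pos n by (simp add: field_simps)
  qed
  moreover have "?p \<le> ennreal (c * exp (- c' * real n * r ^ dim E) * of_bool (r \<le> 1)
                              + c'' * inverse (real n * r\<^sup>2))"
    using bound n \<open>0 < r\<close> 2 unfolding concentration_bound_def Let_def by blast
  ultimately show ?thesis
    by (elim order_trans) (intro ennreal_leI, linarith)
qed

text \<open>
  Points of a product space are restricted to the index set, whereas the ambiguity sets are built from
  the unrestricted sample sequences.
\<close>

lemma empirical_measure_restrict:
  "empirical_measure S n (restrict s {1..n}) = empirical_measure S n s"
  unfolding empirical_measure_def by simp

section \<open>Growth of the thresholds in the horizon\<close>

text \<open>
  With the exponent written as \<open>- a / (N - 1)\<close> for the positive constant \<open>a = - ln \<alpha>\<close>, the thresholds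
  are elementary functions of \<open>N\<close> to which asymptotic expansion applies.
\<close>

lemma powr_horizon:
  assumes "0 < (\<alpha>::real)"
  shows "\<alpha> powr (1 / (real N - 1)) = exp (- (- ln \<alpha>) / (real N - 1))"
  using assms by (simp add: powr_def)

lemma ln_threshold_bigo:
  fixes \<alpha> b c' :: real
  assumes "0 < \<alpha>" "\<alpha> < 1" "0 < c'"
  shows "(\<lambda>N. 1 / c' * (b - ln (1 - \<alpha> powr (1 / (real N - 1))))) \<in> O(\<lambda>N. ln (real N))"
proof -
  define a where "a = - ln \<alpha>"
  have "0 < a"
    using assms by (simp add: a_def)
  then show ?thesis
    unfolding powr_horizon[OF assms(1)] a_def[symmetric] using \<open>0 < c'\<close> by real_asymp
qed

lemma reciprocal_threshold_bigo:
  fixes \<alpha> b :: real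
  assumes "0 < \<alpha>" "\<alpha> < 1"
  shows "(\<lambda>N. b / (1 - \<alpha> powr (1 / (real N - 1)))) \<in> O(\<lambda>N. real N)"
proof -
  define a where "a = - ln \<alpha>"
  have "0 < a"
    using assms by (simp add: a_def)
  then have "(\<lambda>N. 1 / (1 - exp (- a / (real N - 1)))) \<in> O(\<lambda>N. real N)"
    by real_asymp
  from landau_o.big.mult[OF bigo_const[of b] this] show ?thesis
    unfolding powr_horizon[OF assms(1)] a_def[symmetric] by simp
qed

lemma threshold_sub_gaussian_bigo:
  assumes "0 < \<alpha>" "\<alpha> < 1" "0 < c'"
  shows "(\<lambda>N. threshold_sub_gaussian \<alpha> N c c') \<in> O(\<lambda>N. ln (real N))"
  unfolding threshold_sub_gaussian_def using assms by (rule ln_threshold_bigo)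

lemma threshold_third_moments_bigo:
  assumes "0 < \<alpha>" "\<alpha> < 1" "0 < c'"
  shows "(\<lambda>N. threshold_third_moments \<alpha> N c c' c'') \<in> O(\<lambda>N. real N)"
proof -
  let ?u = "\<lambda>N::nat. 1 / c' * (ln (2 * c) - ln (1 - \<alpha> powr (1 / (real N - 1))))"
  let ?v = "\<lambda>N::nat. 2 * c'' / (1 - \<alpha> powr (1 / (real N - 1)))"
  have "(\<lambda>N. ln (real N)) \<in> O(\<lambda>N. real N)"
    by real_asymp
  with ln_threshold_bigo[OF assms] have u: "?u \<in> O(\<lambda>N. real N)"
    by (rule landau_o.big_trans)
  have v: "?v \<in> O(\<lambda>N. real N)"
    using assms(1,2) by (rule reciprocal_threshold_bigo)
  have "norm (max a b) \<le> norm (\<bar>a\<bar> + \<bar>b\<bar>)" for a b :: real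
    by auto
  then have "(\<lambda>N. max (?u N) (?v N)) \<in> O(\<lambda>N. \<bar>?u N\<bar> + \<bar>?v N\<bar>)"
    by (rule landau_o.big_mono[OF always_eventually[OF allI]])
  also have "(\<lambda>N. \<bar>?u N\<bar> + \<bar>?v N\<bar>) \<in> O(\<lambda>N. real N)"
    using landau_o.big.abs_in_iff[THEN iffD2, OF u] landau_o.big.abs_in_iff[THEN iffD2, OF v]
    by (rule sum_in_bigo)
  finally show ?thesis
    unfolding threshold_third_moments_def .
qed

section \<open>Out-of-sample guarantee\<close>

theorem theorem4:
  fixes T :: nat
    and X :: "nat \<Rightarrow> 'x::euclidean_space set"
    and \<Xi> E :: "nat \<Rightarrow> 'e::euclidean_space set"
    and \<delta> n m :: "nat \<Rightarrow> nat"
    and f :: "nat \<Rightarrow> 'x \<Rightarrow> 'x \<Rightarrow> 'e \<Rightarrow> ennreal"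
    and d :: "nat \<Rightarrow> 'e \<Rightarrow> 'e \<Rightarrow> real"
    and g :: "nat \<Rightarrow> nat \<Rightarrow> 'e \<Rightarrow> real"
    and \<rho> :: "nat \<Rightarrow> nat \<Rightarrow> real"
    and \<nu> :: "nat \<Rightarrow> 'e measure"
    and C C' C'' :: "nat \<Rightarrow> real"
    and M :: "'s measure"
    and \<xi> :: "nat \<Rightarrow> nat \<Rightarrow> 's \<Rightarrow> 'e"
    and x0 :: 'x and \<xi>1 :: 'e
    and P :: "'s \<Rightarrow> nat \<Rightarrow> 'e measure set"
    and x1 :: "'s \<Rightarrow> 'x"
    and pol :: "'s \<Rightarrow> nat \<Rightarrow> 'x \<Rightarrow> 'e \<Rightarrow> 'x"
  assumes horizon: "T \<ge> 2"
    and states: "X 0 = {x0}" "\<And>t. t \<in> {1..T} \<Longrightarrow> convex (X t)"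
    and uncertainty: "\<Xi> 1 = {\<xi>1}"
      "\<And>t. t \<in> {1..T} \<Longrightarrow> subspace (E t) \<and> dim (E t) = \<delta> t \<and> \<Xi> t \<subseteq> E t"
    and cost_lsc: "\<And>t. t \<in> {1..T} \<Longrightarrow>
      lsc_on (X (t - 1) \<times> X t \<times> \<Xi> t) (\<lambda>(x, y, z). f t x y z)"
    and cost_convex: "\<And>t z. t \<in> {1..T} \<Longrightarrow> z \<in> \<Xi> t \<Longrightarrow>
      ennreal_convex_on (X (t - 1) \<times> X t) (\<lambda>(x, y). f t x y z)"
    and distance: "\<And>t. t \<in> {2..T} \<Longrightarrow> Metric_space (\<Xi> t) (d t)"
    and moment_functions: "\<And>t j. t \<in> {2..T} \<Longrightarrow> j \<in> {1..m t} \<Longrightarrow>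
      continuous_on (\<Xi> t) (g t j) \<and>
      (\<exists>K>0. \<exists>z\<in>\<Xi> t. \<forall>y\<in>\<Xi> t. \<bar>g t j y\<bar> \<le> K * (1 + d t z y))"
    and radius: "\<And>t. t \<in> {2..T} \<Longrightarrow> \<rho> t 0 > 0"
    and true_distribution: "\<And>t. t \<in> {2..T} \<Longrightarrow> \<nu> t \<in> wasserstein_space (\<Xi> t) (d t)"
    and true_moments: "\<And>t j. t \<in> {2..T} \<Longrightarrow> j \<in> {1..m t} \<Longrightarrow> (\<integral>z. g t j z \<partial>\<nu> t) \<le> \<rho> t j"
    and constants: "\<And>t. t \<in> {2..T} \<Longrightarrow> C t > 0 \<and> C' t > 0 \<and> C'' t > 0 \<and>
      concentration_bound (E t) (\<Xi> t) (d t) (\<nu> t) (C t) (C' t) (C'' t)"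
    and sample_space: "prob_space M"
    and sample_size: "\<And>t. t \<in> {2..T} \<Longrightarrow> n t \<ge> 1"
    and samples_distr: "\<And>t k. t \<in> {2..T} \<Longrightarrow> k \<in> {1..n t} \<Longrightarrow>
      distr M (borel_on (\<Xi> t)) (\<xi> t k) = \<nu> t"
    and samples_indep: "prob_space.indep_vars M (\<lambda>(t, k). borel_on (\<Xi> t)) (\<lambda>(t, k). \<xi> t k)
      (SIGMA t:{2..T}. {1..n t})"
    and ambiguity: "\<And>\<omega> t. \<omega> \<in> space M \<Longrightarrow> t \<in> {2..T} \<Longrightarrow>
      P \<omega> t = ambiguity_set (\<Xi> t) (d t)
                (empirical_measure (\<Xi> t) (n t) (\<lambda>k. \<xi> t k \<omega>)) (m t) (g t) (\<rho> t)"
    and policy: "\<And>\<omega>. \<omega> \<in> space M \<Longrightarrow>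
      optimal_policy T X \<Xi> f (P \<omega>) x0 \<xi>1 (x1 \<omega>) (pol \<omega>)"
  shows "(\<forall>\<alpha>. 0 < \<alpha> \<and> \<alpha> < 1 \<and>
            (\<forall>t\<in>{2..T}.
               (sub_gaussian (E t) (\<nu> t) \<and> \<delta> t \<ge> 3 \<and>
                real (n t) * min (\<rho> t 0 ^ \<delta> t) ((\<rho> t 0)\<^sup>2)
                  \<ge> threshold_sub_gaussian \<alpha> T (C t) (C' t)) \<or>
               (finite_third_moments (\<nu> t) \<and> \<delta> t \<ge> 2 \<and>
                real (n t) * min (\<rho> t 0 ^ \<delta> t) ((\<rho> t 0)\<^sup>2)
                  \<ge> threshold_third_moments \<alpha> T (C t) (C' t) (C'' t)))
          \<longrightarrow> prob_at_least M
                {\<omega> \<in> space M. eval_cost T f \<nu> x0 \<xi>1 (x1 \<omega>) (pol \<omega>)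
                                \<le> value_function T X f (P \<omega>) 1 x0 \<xi>1} \<alpha>) \<and>
         (\<forall>\<alpha> c c' c''. 0 < \<alpha> \<and> \<alpha> < 1 \<and> 0 < c \<and> 0 < c' \<and> 0 < c'' \<longrightarrow>
            (\<lambda>N. threshold_sub_gaussian \<alpha> N c c') \<in> O(\<lambda>N. ln (real N)) \<and>
            (\<lambda>N. threshold_third_moments \<alpha> N c c' c'') \<in> O(\<lambda>N. real N))"
proof (intro conjI allI impI)
  interpret prob_space M by (fact sample_space)
  fix \<alpha> :: real
  assume asm: "0 < \<alpha> \<and> \<alpha> < 1 \<and>
      (\<forall>t\<in>{2..T}.
         (sub_gaussian (E t) (\<nu> t) \<and> \<delta> t \<ge> 3 \<and>
          real (n t) * min (\<rho> t 0 ^ \<delta> t) ((\<rho> t 0)\<^sup>2)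
            \<ge> threshold_sub_gaussian \<alpha> T (C t) (C' t)) \<or>
         (finite_third_moments (\<nu> t) \<and> \<delta> t \<ge> 2 \<and>
          real (n t) * min (\<rho> t 0 ^ \<delta> t) ((\<rho> t 0)\<^sup>2)
            \<ge> threshold_third_moments \<alpha> T (C t) (C' t) (C'' t)))"
  define \<beta> where "\<beta> = \<alpha> powr (1 / (real T - 1))"
  have \<beta>: "0 < \<beta>" "\<beta> < 1"
    using asm horizon powr_less_mono2[of "1 / (real T - 1)" \<alpha> 1] by (auto simp: \<beta>_def)
  have card: "\<beta> ^ card {2..T} = \<alpha>"
    using asm horizon by (simp add: \<beta>_def powr_power of_nat_diff)
  have \<nu>: "sets (\<nu> t) = sets (borel_on (\<Xi> t))" if "t \<in> {2..T}" for t
    using true_distribution[OF that] by (auto simp: wasserstein_space_def)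
  let ?N = "\<lambda>t. PiM {1..n t} (\<lambda>_. borel_on (\<Xi> t))"
  let ?S = "\<lambda>t. PiM {1..n t} (\<lambda>_. \<nu> t)"
  let ?Y = "\<lambda>t \<omega>. \<lambda>k\<in>{1..n t}. \<xi> t k \<omega>"
  let ?bad = "\<lambda>t. {s \<in> space (?S t).
      wasserstein (\<Xi> t) (d t) (\<nu> t) (empirical_measure (\<Xi> t) (n t) s) > ennreal (\<rho> t 0)}"
  have sets_S: "sets (?S t) = sets (?N t)" if "t \<in> {2..T}" for t
    using \<nu>[OF that] by (intro sets_PiM_cong) auto
  \<comment> \<open>Each failure event is covered by a measurable set of the same outer measure.\<close>
  have "\<forall>t\<in>{2..T}. \<exists>B. B \<in> sets (?N t) \<and> ?bad t \<subseteq> B \<and> emeasure (?S t) B \<le> ennreal (1 - \<beta>)"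
  proof
    fix t assume t: "t \<in> {2..T}"
    have dim: "dim (E t) = \<delta> t"
      using uncertainty(2)[of t] t by auto
    have "outer_measure_of (?S t) (?bad t) \<le> ennreal (1 - \<beta>)"
    proof (rule wasserstein_tail_le)
      show "concentration_bound (E t) (\<Xi> t) (d t) (\<nu> t) (C t) (C' t) (C'' t)"
        "0 < C t" "0 < C' t" "0 < C'' t"
        using constants[OF t] by auto
      show "sub_gaussian (E t) (\<nu> t) \<and> 3 \<le> dim (E t) \<and>
            1 / C' t * (ln (C t) - ln (1 - \<beta>)) \<le> real (n t) * min (\<rho> t 0 ^ dim (E t)) ((\<rho> t 0)\<^sup>2) \<or>
          finite_third_moments (\<nu> t) \<and> 2 \<le> dim (E t) \<and>
            max (1 / C' t * (ln (2 * C t) - ln (1 - \<beta>))) (2 * C'' t / (1 - \<beta>))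
              \<le> real (n t) * min (\<rho> t 0 ^ dim (E t)) ((\<rho> t 0)\<^sup>2)"
        using bspec[OF conjunct2[OF conjunct2[OF asm]] t]
        unfolding dim \<beta>_def threshold_sub_gaussian_def threshold_third_moments_def .
    qed (use radius[OF t] sample_size[OF t] \<beta> in auto)
    moreover obtain B where "B \<in> sets (?S t)" "?bad t \<subseteq> B"
      "outer_measure_of (?S t) (?bad t) = emeasure (?S t) B"
      using outer_measure_of_attain[of "?bad t" "?S t"] by auto
    ultimately show "\<exists>B. B \<in> sets (?N t) \<and> ?bad t \<subseteq> B \<and> emeasure (?S t) B \<le> ennreal (1 - \<beta>)"
      using sets_S[OF t] by auto
  qed
  from bchoice[OF this] obtain B where "\<forall>t\<in>{2..T}.
      B t \<in> sets (?N t) \<and> ?bad t \<subseteq> B t \<and> emeasure (?S t) (B t) \<le> ennreal (1 - \<beta>)" ..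
  then have B: "B t \<in> sets (?N t)" "?bad t \<subseteq> B t" "emeasure (?S t) (B t) \<le> ennreal (1 - \<beta>)"
    if "t \<in> {2..T}" for t
    using that by simp_all
  have distr_Y: "distr M (?N t) (?Y t) = ?S t" if t: "t \<in> {2..T}" for t
  proof -
    have "distr M (?N t) (?Y t) = PiM {1..n t} (\<lambda>k. distr M (borel_on (\<Xi> t)) (\<xi> t k))"
      using distr_block[OF samples_indep t] sample_size[OF t] by simp
    also have "\<dots> = ?S t"
      using samples_distr[OF t] by (intro PiM_cong) auto
    finally show ?thesis .
  qed
  have indep_Y: "indep_vars ?N ?Y {2..T}"
    by (rule indep_vars_blocks[OF samples_indep])
  have B_le: "measure (distr M (?N t) (?Y t)) (B t) \<le> 1 - \<beta>" if "t \<in> {2..T}" for t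
    unfolding distr_Y[OF that] measure_def using B(3)[OF that] \<beta> by (intro enn2real_leI) auto
  let ?G = "{\<omega> \<in> space M. \<forall>t\<in>{2..T}. ?Y t \<omega> \<notin> B t}"
  have G: "?G \<in> events" "\<alpha> \<le> prob ?G"
    using indep_vars_prob_avoid[of ?N ?Y "{2..T}" B \<beta>, OF indep_Y _ _ B(1) B_le] horizon \<beta> card
    by auto
  have "eval_cost T f \<nu> x0 \<xi>1 (x1 \<omega>) (pol \<omega>) \<le> value_function T X f (P \<omega>) 1 x0 \<xi>1"
    if \<omega>: "\<omega> \<in> ?G" for \<omega>
  proof (rule eval_cost_le_value_function)
    show "optimal_policy T X \<Xi> f (P \<omega>) x0 \<xi>1 (x1 \<omega>) (pol \<omega>)"
      using \<omega> policy by auto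
    fix t assume t: "t \<in> {2..T}"
    show "space (\<nu> t) = \<Xi> t"
      using sets_eq_imp_space_eq[OF \<nu>[OF t]] by (simp add: space_restrict_space)
    have "?Y t \<omega> \<in> space (?N t)"
      using indep_Y t \<omega> unfolding indep_vars_def by (blast dest: measurable_space)
    then have "?Y t \<omega> \<in> space (?S t)"
      using sets_eq_imp_space_eq[OF sets_S[OF t]] by simp
    moreover have "?Y t \<omega> \<notin> B t"
      using \<omega> t by blast
    ultimately have "\<not> wasserstein (\<Xi> t) (d t) (\<nu> t) (empirical_measure (\<Xi> t) (n t) (?Y t \<omega>))
        > ennreal (\<rho> t 0)"
      using B(2)[OF t] by blast
    then have "wasserstein (\<Xi> t) (d t) (\<nu> t) (empirical_measure (\<Xi> t) (n t) (\<lambda>k. \<xi> t k \<omega>))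
        \<le> ennreal (\<rho> t 0)"
      unfolding empirical_measure_restrict not_less .
    then show "\<nu> t \<in> P \<omega> t"
      using \<omega> ambiguity[OF _ t] true_distribution[OF t] true_moments[OF t]
      by (auto simp: ambiguity_set_def)
  qed
  then show "prob_at_least M {\<omega> \<in> space M. eval_cost T f \<nu> x0 \<xi>1 (x1 \<omega>) (pol \<omega>)
      \<le> value_function T X f (P \<omega>) 1 x0 \<xi>1} \<alpha>"
    unfolding prob_at_least_def using G by (intro bexI[of _ ?G]) auto
next
  fix \<alpha> c c' c'' :: real
  assume "0 < \<alpha> \<and> \<alpha> < 1 \<and> 0 < c \<and> 0 < c' \<and> 0 < c''"
  then show "(\<lambda>N. threshold_sub_gaussian \<alpha> N c c') \<in> O(\<lambda>N. ln (real N))"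
    and "(\<lambda>N. threshold_third_moments \<alpha> N c c' c'') \<in> O(\<lambda>N. real N)"
    by (auto intro: threshold_sub_gaussian_bigo threshold_third_moments_bigo)
qed

end
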